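(* Let $\langle d,k,m\rangle\in M_n\setminus\{\mathbf{0}\}$. If $d=0$ then $\langle d,k,m\rangle$ is idempotent; if $d\ne 0$ then it is nilpotent, and its nilpotency index $\ell$ (the smallest $j\in\mathbb{N}$ with $\langle d,k,m\rangle^j=\mathbf{0}$) is $$\ell=1+\left\lceil\frac{m-k+1}{|d|}\right\rceil,$$ and satisfies $2\le\ell\le n$.
   Context: Fix an integer $n\ge 2$. For integers $d,k,m$ with $1-\min(0,d)\le k\le m\le n-\max(0,d)$, let $\langle d,k,m\rangle$ denote the $n\times n$ matrix with entries $x_{ij}$ ($i,j\in\{1,\dots,n\}$) equal to $1$ if $k\le i\le m$ and $j-i=d$, and $0$ otherwise (it has $m-k+1$ ones). Let $\mathbf{0}$ be the $n\times n$ zero matrix and $M_n=\{\mathbf{0}\}\cup\{\langle d,k,m\rangle: d\in\mathbb{Z},\ k,m\in\mathbb{N},\ 1-\min(0,d)\le k\le m\le n-\max(0,d)\}$, a monoid under matrix multiplication. $\lceil t\rceil$ is the ceiling of $t$. *)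

theory Defs
  imports Complex_Main "Jordan_Normal_Form.Matrix"
begin

definition diag_params :: "nat \<Rightarrow> int \<Rightarrow> nat \<Rightarrow> nat \<Rightarrow> bool" where
  "diag_params n d k m \<longleftrightarrow>
     1 - min 0 d \<le> int k \<and> k \<le> m \<and> int m \<le> int n - max 0 d"

text \<open>
  Matrices of type \<^typ>\<open>'a mat\<close> have row and column indices starting at 0, so the entry
  in row \<open>i\<close> and column \<open>j\<close> below is the entry with indices \<open>i + 1\<close> and \<open>j + 1\<close> in the
  numbering by \<open>1, \<dots>, n\<close>. The shift cancels in the condition \<open>j - i = d\<close>.
\<close>

definition diag_segment :: "nat \<Rightarrow> int \<Rightarrow> nat \<Rightarrow> nat \<Rightarrow> 'a :: semiring_1 mat" where
  "diag_segment n d k m =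
     mat n n (\<lambda>(i, j). if k \<le> i + 1 \<and> i + 1 \<le> m \<and> int j - int i = d then 1 else 0)"

definition diag_monoid :: "nat \<Rightarrow> 'a :: semiring_1 mat set" where
  "diag_monoid n = {0\<^sub>m n n} \<union> {diag_segment n d k m | d k m. diag_params n d k m}"

definition idempotent_mat :: "'a :: semiring_1 mat \<Rightarrow> bool" where
  "idempotent_mat A \<longleftrightarrow> A * A = A"

definition nilpotent_mat :: "'a :: semiring_1 mat \<Rightarrow> bool" where
  "nilpotent_mat A \<longleftrightarrow> (\<exists>j. A ^\<^sub>m j = 0\<^sub>m (dim_row A) (dim_col A))"

text \<open>
  The exponent 0 is harmless here and in \<^const>\<open>nilpotent_mat\<close>: the zeroth power is the
  identity matrix, which is nonzero as soon as there is at least one row.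
\<close>

definition nilpotency_index :: "'a :: semiring_1 mat \<Rightarrow> nat" where
  "nilpotency_index A = (LEAST j. A ^\<^sub>m j = 0\<^sub>m (dim_row A) (dim_col A))"

end

theory Submission
  imports Defs
begin

text \<open>
  Regard \<open>\<langle>d, k, m\<rangle>\<close> as the partial translation \<open>i \<mapsto> i + d\<close> of the indices, defined for
  \<open>k \<le> i \<le> m\<close>. Composing such maps intersects their domains, pulled back along the translations,
  so the power with exponent \<open>r + 1\<close> translates by \<open>(r + 1) * d\<close> an interval from which \<open>r * \<bar>d\<bar>\<close>
  points have been cut off at the end towards which the translation moves. The power vanishes
  exactly when this leaves nothing of the \<open>m - k + 1\<close> points.
\<close>

lemma nilpotency_index_le_iff:
  fixes A :: "'a :: semiring_1 mat"
  assumes "A \<in> carrier_mat n n" and "nilpotent_mat A"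
  shows "nilpotency_index A \<le> j \<longleftrightarrow> A ^\<^sub>m j = 0\<^sub>m n n"
proof
  have index: "nilpotency_index A = (LEAST j. A ^\<^sub>m j = 0\<^sub>m n n)"
    using assms(1) by (simp add: nilpotency_index_def)
  show "nilpotency_index A \<le> j" if "A ^\<^sub>m j = 0\<^sub>m n n"
    unfolding index using that by (rule Least_le)
  assume "nilpotency_index A \<le> j"
  then show "A ^\<^sub>m j = 0\<^sub>m n n"
  proof (induction j rule: dec_induct)
    case base
    show ?case
      unfolding index using assms by (auto simp: nilpotent_mat_def intro: LeastI_ex)
  next
    case (step j)
    with assms(1) show ?case
      by simp
  qed
qed

lemma nilpotency_index_ge_2:
  fixes A :: "'a :: semiring_1 mat"
  assumes "A \<in> carrier_mat n n" and "nilpotent_mat A" and "A \<noteq> 0\<^sub>m n n"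
  shows "2 \<le> nilpotency_index A"
proof -
  have "A ^\<^sub>m 1 \<noteq> 0\<^sub>m n n"
    using assms(1,3) by simp
  then show ?thesis
    unfolding nilpotency_index_le_iff[OF assms(1,2), symmetric] by simp
qed

lemma diag_params_iff: "diag_params n d k m \<longleftrightarrow> nat (- d) < k \<and> k \<le> m \<and> m + nat d \<le> n"
  by (auto simp: diag_params_def)

lemma diag_segment_carrier [simp]: "diag_segment n d k m \<in> carrier_mat n n"
  by (simp add: diag_segment_def)

text \<open>
  Truncating the bounds at 0 is harmless here and in the powers below: since rows are numbered
  from 1, a lower bound below 1 excludes no row and an upper bound below 1 excludes all of them.
\<close>

lemma diag_segment_mult:
  assumes "1 \<le> k'" and "m' \<le> n"
  shows "diag_segment n d k m * diag_segment n d' k' m' =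
    (diag_segment n (d + d') (max k (nat (int k' - d))) (min m (nat (int m' - d)))
      :: 'a :: semiring_1 mat)" (is "?A * ?B = ?C")
proof (rule eq_matI)
  fix i j
  assume "i < dim_row ?C" and "j < dim_col ?C"
  then have i: "i < n" and j: "j < n"
    by (simp_all add: diag_segment_def)
  let ?l = "int i + d"
  let ?P = "k \<le> i + 1 \<and> i + 1 \<le> m \<and> int k' \<le> ?l + 1 \<and> ?l + 1 \<le> int m' \<and> int j - int i = d + d'"
  have "(?A * ?B) $$ (i, j) = (\<Sum>l<n. ?A $$ (i, l) * ?B $$ (l, j))"
    using i j by (simp add: diag_segment_def scalar_prod_def lessThan_atLeast0)
  also have "\<dots> = (\<Sum>l<n. if l = nat ?l then if ?P then 1 else 0 else 0)"
    using i j \<open>1 \<le> k'\<close> by (intro sum.cong) (auto simp: diag_segment_def)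
  also have "\<dots> = (if ?P then 1 else 0)"
    using \<open>1 \<le> k'\<close> \<open>m' \<le> n\<close> by (subst sum.delta) auto
  also have "\<dots> = ?C $$ (i, j)"
    using i j by (auto simp: diag_segment_def)
  finally show "(?A * ?B) $$ (i, j) = ?C $$ (i, j)" .
qed (simp_all add: diag_segment_def)

lemma pow_Suc_diag_segment:
  assumes "1 \<le> k" and "m \<le> n"
  shows "(diag_segment n d k m :: 'a :: semiring_1 mat) ^\<^sub>m Suc r =
    diag_segment n (int (Suc r) * d) (k + r * nat (- d)) (m - r * nat d)"
proof (induction r)
  case 0
  show ?case
    by (simp add: left_mult_one_mat[OF diag_segment_carrier] diag_segment_def)
next
  case (Suc r)
  let ?t = "int (Suc r) * d"
  have lower: "max (k + r * nat (- d)) (nat (int k - ?t)) = k + Suc r * nat (- d)"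
    by (cases d rule: int_cases2)
      (auto simp: algebra_simps max_def nat_le_iff nat_eq_iff simp flip: of_nat_mult)
  have upper: "min (m - r * nat d) (nat (int m - ?t)) = m - Suc r * nat d"
    by (cases d rule: int_cases2)
      (auto simp: algebra_simps min_def le_nat_iff nat_eq_iff simp flip: of_nat_mult)
  have shift: "?t + d = int (Suc (Suc r)) * d"
    by (simp add: algebra_simps)
  show ?case
    unfolding pow_mat.simps(2)[of _ "Suc r"] Suc.IH diag_segment_mult[OF assms] lower upper shift ..
qed

lemma diag_segment_eq_zero: "m < k \<Longrightarrow> diag_segment n d k m = 0\<^sub>m n n"
  by (auto simp: diag_segment_def)

lemma diag_segment_neq_zero:
  assumes "diag_params n d k m"
  shows "diag_segment n d k m \<noteq> (0\<^sub>m n n :: 'a :: semiring_1 mat)"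
proof
  assume zero: "diag_segment n d k m = (0\<^sub>m n n :: 'a mat)"
  define i j where "i = k - 1" and "j = nat (int i + d)"
  have "i < n" "j < n" "k \<le> i + 1" "i + 1 \<le> m" "int j - int i = d"
    using assms by (auto simp: diag_params_def i_def j_def)
  then have "(diag_segment n d k m :: 'a mat) $$ (i, j) = 1"
    by (simp add: diag_segment_def)
  with zero \<open>i < n\<close> \<open>j < n\<close> show False
    by simp
qed

lemma pow_Suc_diag_segment_eq_zero_iff:
  assumes "diag_params n d k m"
  shows "(diag_segment n d k m :: 'a :: semiring_1 mat) ^\<^sub>m Suc r = 0\<^sub>m n n \<longleftrightarrow>
    int m - int k < int r * \<bar>d\<bar>"
proof -
  let ?d = "int (Suc r) * d" and ?k = "k + r * nat (- d)" and ?m = "m - r * nat d"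
  have "1 \<le> k" and "m \<le> n"
    using assms by (auto simp: diag_params_def)
  have "?m < ?k \<longleftrightarrow> int m - int k < int r * \<bar>d\<bar>"
    using \<open>1 \<le> k\<close> by (cases d rule: int_cases2) (auto simp flip: of_nat_mult)
  moreover have "diag_params n ?d ?k ?m" if "?k \<le> ?m"
    using assms that
    by (cases d rule: int_cases2) (auto simp: diag_params_iff algebra_simps simp flip: of_nat_mult)
  ultimately show ?thesis
    unfolding pow_Suc_diag_segment[OF \<open>1 \<le> k\<close> \<open>m \<le> n\<close>]
    using diag_segment_eq_zero diag_segment_neq_zero by (metis not_less)
qed

lemma pow_dim_diag_segment_eq_zero:
  assumes "diag_params n d k m" and "d \<noteq> 0"
  shows "(diag_segment n d k m :: 'a :: semiring_1 mat) ^\<^sub>m n = 0\<^sub>m n n"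
proof (cases n)
  case 0
  with assms(1) show ?thesis
    by (auto simp: diag_params_iff)
next
  case (Suc r)
  have "int m - int k < int r"
    using assms Suc by (auto simp: diag_params_iff)
  also have "\<dots> \<le> int r * \<bar>d\<bar>"
    using \<open>d \<noteq> 0\<close> mult_left_mono[of 1 "\<bar>d\<bar>" "int r"] by simp
  finally show ?thesis
    using pow_Suc_diag_segment_eq_zero_iff[OF assms(1)] Suc by metis
qed

lemma nilpotent_diag_segment:
  assumes "diag_params n d k m" and "d \<noteq> 0"
  shows "nilpotent_mat (diag_segment n d k m :: 'a :: semiring_1 mat)"
  using pow_dim_diag_segment_eq_zero[OF assms]
    carrier_matD[OF diag_segment_carrier[of n d k m, where ?'a = 'a]]
  by (auto simp: nilpotent_mat_def)

lemma nilpotency_index_diag_segment: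
  assumes "diag_params n d k m" and "d \<noteq> 0"
  shows "int (nilpotency_index (diag_segment n d k m :: 'a :: semiring_1 mat)) =
    1 + \<lceil>(real m - real k + 1) / real_of_int \<bar>d\<bar>\<rceil>" (is "int (nilpotency_index ?A) = 1 + ?c")
proof -
  note nilpotent = nilpotent_diag_segment[OF assms, where ?'a = 'a]
  have "2 \<le> nilpotency_index ?A"
    using diag_segment_neq_zero[OF assms(1)] nilpotent by (intro nilpotency_index_ge_2) auto
  then obtain l where l: "nilpotency_index ?A = Suc l" and "1 \<le> l"
    by (cases "nilpotency_index ?A") auto
  have "l \<le> r \<longleftrightarrow> ?c \<le> int r" for r
  proof -
    have "l \<le> r \<longleftrightarrow> ?A ^\<^sub>m Suc r = 0\<^sub>m n n"
      using nilpotency_index_le_iff[OF diag_segment_carrier nilpotent, of "Suc r"] l by simp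
    also have "\<dots> \<longleftrightarrow> int m - int k + 1 \<le> int r * \<bar>d\<bar>"
      unfolding pow_Suc_diag_segment_eq_zero_iff[OF assms(1)] by linarith
    also have "\<dots> \<longleftrightarrow> real_of_int (int m - int k + 1) \<le> real_of_int (int r * \<bar>d\<bar>)"
      by (simp only: of_int_le_iff)
    also have "\<dots> \<longleftrightarrow> ?c \<le> int r"
      using \<open>d \<noteq> 0\<close> by (simp add: ceiling_le_iff pos_divide_le_eq)
    finally show ?thesis .
  qed
  from this[of l] this[of "nat ?c"] have "?c = int l"
    using \<open>1 \<le> l\<close> by linarith
  with l show ?thesis
    by simp
qed

theorem theorem4:
  fixes n k m :: nat and d :: int and A :: "'a :: semiring_1 mat"
  assumes "n \<ge> 2"
    and "diag_params n d k m"
    and "A = diag_segment n d k m"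
    and "A \<in> diag_monoid n - {0\<^sub>m n n}"
  shows "(d = 0 \<longrightarrow> idempotent_mat A) \<and>
         (d \<noteq> 0 \<longrightarrow>
            nilpotent_mat A \<and>
            int (nilpotency_index A) = 1 + \<lceil>(real m - real k + 1) / real_of_int \<bar>d\<bar>\<rceil> \<and>
            2 \<le> nilpotency_index A \<and> nilpotency_index A \<le> n)"
proof (intro conjI[of "d = 0 \<longrightarrow> _"] impI)
  show "idempotent_mat A" if "d = 0"
    using assms(2) that by (simp add: assms(3) idempotent_mat_def diag_segment_mult diag_params_iff)
  assume "d \<noteq> 0"
  have A: "A \<in> carrier_mat n n"
    by (simp add: assms(3))
  have nilpotent: "nilpotent_mat A"
    unfolding assms(3) using assms(2) \<open>d \<noteq> 0\<close> by (rule nilpotent_diag_segment)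
  moreover have "int (nilpotency_index A) = 1 + \<lceil>(real m - real k + 1) / real_of_int \<bar>d\<bar>\<rceil>"
    unfolding assms(3) using assms(2) \<open>d \<noteq> 0\<close> by (rule nilpotency_index_diag_segment)
  moreover have "2 \<le> nilpotency_index A"
    using A nilpotent assms(4) by (intro nilpotency_index_ge_2) auto
  moreover have "nilpotency_index A \<le> n"
    unfolding nilpotency_index_le_iff[OF A nilpotent] unfolding assms(3)
    using assms(2) \<open>d \<noteq> 0\<close> by (rule pow_dim_diag_segment_eq_zero)
  ultimately show "nilpotent_mat A \<and>
      int (nilpotency_index A) = 1 + \<lceil>(real m - real k + 1) / real_of_int \<bar>d\<bar>\<rceil> \<and>
      2 \<le> nilpotency_index A \<and> nilpotency_index A \<le> n"
    by blast
qed

end
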